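(* Let $n, K$ be positive integers and let $(\alpha_1, \ldots, \alpha_K)$ be a non-increasing sequence of positive real numbers such that $\alpha_1 \leq \frac{1}{n} \sum_{i=1}^K \alpha_i$. For a sequence $(v_1,\ldots,v_K)$ of vectors in $\mathbb{R}^n$, let $G_{(v_1,\ldots,v_K)}$ denote its frame operator. Consider the following three optimization problems over sequences $(v_1,\ldots,v_K)$ of vectors in $\mathbb{R}^n$, all having the same constraints, namely $\langle v_i, v_i\rangle = \alpha_i$ for all $i = 1,\ldots,K$ and $\operatorname{span}(v_1,\ldots,v_K) = \mathbb{R}^n$: (P1) minimize $\operatorname{tr}\big(G_{(v_1,\ldots,v_K)}^{-1}\big)$ subject to these constraints; (P2) minimize $\lambda_{\min}^{-1}\big(G_{(v_1,\ldots,v_K)}\big)$ subject to these constraints; (P3) maximize $\det\big(G_{(v_1,\ldots,v_K)}\big)$ subject to these constraints. Then, for each of the three problems (P1), (P2), (P3), a feasible sequence $(v_1,\ldots,v_K)$ is an optimal solution of the problem if and only if it is a tight frame of $\mathbb{R}^n$.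
   Context: $\mathbb{R}^n$ carries the standard inner product $\langle\cdot,\cdot\rangle$ and the norm $\|\cdot\|$ it induces. The frame operator of a sequence $(v_1,\ldots,v_K)$ of vectors in $\mathbb{R}^n$ is the linear map $G_{(v_1,\ldots,v_K)}:\mathbb{R}^n\to\mathbb{R}^n$, $G_{(v_1,\ldots,v_K)}(v) = \sum_{i=1}^K \langle v, v_i\rangle v_i$, identified with the matrix $\sum_{i=1}^K v_i v_i^\top$. It is symmetric positive definite when the vectors span $\mathbb{R}^n$. $\lambda_{\min}(G)$ is the smallest eigenvalue of $G$ and $\lambda_{\min}^{-1}(G) = 1/\lambda_{\min}(G)$; $\operatorname{tr}$ is the trace. A sequence $(v_1,\ldots,v_K)$ in $\mathbb{R}^n$ is a frame of $\mathbb{R}^n$ if it spans $\mathbb{R}^n$; a frame is tight if there exists a number $a>0$ such that $a\|v\|^2 = \sum_{i=1}^K |\langle v, v_i\rangle|^2$ for every $v\in\mathbb{R}^n$. *)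

theory Defs
  imports "HOL-Analysis.Analysis"
begin

text \<open>
  A sequence of \<^term>\<open>K\<close> vectors is a function on \<^typ>\<open>nat\<close> of which only the values at the
  indices in \<^term>\<open>{1..K}\<close> matter. The ambient dimension is \<^term>\<open>CARD('n)\<close>.
\<close>

definition frame_operator :: "nat \<Rightarrow> (nat \<Rightarrow> real ^ 'n) \<Rightarrow> real ^ 'n \<Rightarrow> real ^ 'n" where
  "frame_operator K v w = (\<Sum>i = 1..K. (w \<bullet> v i) *\<^sub>R v i)"

definition frame_matrix :: "nat \<Rightarrow> (nat \<Rightarrow> real ^ 'n) \<Rightarrow> real ^ 'n ^ 'n" where
  "frame_matrix K v = matrix (frame_operator K v)"

definition is_frame :: "nat \<Rightarrow> (nat \<Rightarrow> real ^ 'n) \<Rightarrow> bool" where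
  "is_frame K v \<longleftrightarrow> span (v ` {1..K}) = UNIV"

definition is_tight_frame :: "nat \<Rightarrow> (nat \<Rightarrow> real ^ 'n) \<Rightarrow> bool" where
  "is_tight_frame K v \<longleftrightarrow>
     is_frame K v \<and> (\<exists>a > 0. \<forall>w. a * (norm w)\<^sup>2 = (\<Sum>i = 1..K. \<bar>w \<bullet> v i\<bar>\<^sup>2))"

definition is_eigenvalue :: "real ^ 'n ^ 'n \<Rightarrow> real \<Rightarrow> bool" where
  "is_eigenvalue A l \<longleftrightarrow> (\<exists>x. x \<noteq> 0 \<and> A *v x = l *\<^sub>R x)"

text \<open>Only meaningful for matrices with a real eigenvalue, such as symmetric ones.\<close>

definition lambda_min :: "real ^ 'n ^ 'n \<Rightarrow> real" where
  "lambda_min A = (LEAST l. is_eigenvalue A l)"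

definition feasible :: "nat \<Rightarrow> (nat \<Rightarrow> real) \<Rightarrow> (nat \<Rightarrow> real ^ 'n) \<Rightarrow> bool" where
  "feasible K \<alpha> v \<longleftrightarrow> (\<forall>i \<in> {1..K}. v i \<bullet> v i = \<alpha> i) \<and> span (v ` {1..K}) = UNIV"

end

theory Submission
  imports Defs
begin

text \<open>
  All three objectives depend only on the eigenvalues of the frame operator, which are positive
  and have the prescribed sum \<open>\<Sum>i \<alpha>\<^sub>i = n c\<close>. For such eigenvalues the sum of
  the inverses, the inverse of the minimum and the negated product are all smallest exactly when
  every eigenvalue is \<open>c\<close>, that is, when the frame is tight. It remains to see that a tight
  frame with the prescribed norms exists. Start from \<open>n\<close> orthogonal vectors of squared norm
  \<open>c\<close> together with zero vectors; rotating a pair of vectors into each other changes neither the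
  frame operator nor the sum of the squared norms, and by the intermediate value theorem such
  rotations correct the norms one after the other.
\<close>

subsection \<open>Diagonalization of real symmetric matrices\<close>

text \<open>The form at \<open>x - t *\<^sub>R g x\<close> is nonnegative for every
  \<open>t\<close>, yet it equals \<open>- 2 * t * b + t\<^sup>2 * c\<close> with \<open>b\<close>
  the squared norm of \<open>g x\<close>; a positive \<open>b\<close> would make this negative for
  small positive \<open>t\<close>. This takes the place of differentiating the Rayleigh quotient at
  a minimiser.\<close>

lemma psd_isotropic_in_kernel:
  fixes g :: "'a::real_inner \<Rightarrow> 'a"
  assumes "linear g" and sa: "\<And>x y. g x \<bullet> y = x \<bullet> g y"
    and W: "subspace W" "\<And>x. x \<in> W \<Longrightarrow> g x \<in> W"
    and psd: "\<And>x. x \<in> W \<Longrightarrow> 0 \<le> x \<bullet> g x"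
    and x: "x \<in> W" "x \<bullet> g x = 0"
  shows "g x = 0"
proof -
  interpret g: linear g by fact
  define b c where "b = g x \<bullet> g x" and "c = g x \<bullet> g (g x)"
  have ineq: "0 \<le> - 2 * t * b + t\<^sup>2 * c" for t
  proof -
    have "x - t *\<^sub>R g x \<in> W"
      using W x by (simp add: subspace_diff subspace_scale)
    then have "0 \<le> (x - t *\<^sub>R g x) \<bullet> g (x - t *\<^sub>R g x)"
      by (rule psd)
    also have "\<dots> = - 2 * t * b + t\<^sup>2 * c"
      using x(2) sa[of x "g x"]
      by (simp add: b_def c_def g.diff g.scale inner_diff algebra_simps power2_eq_square)
    finally show ?thesis .
  qed
  have c: "0 \<le> c"
    unfolding c_def using W x psd by blast
  have "b \<le> 0"
  proof (rule ccontr)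
    assume "\<not> b \<le> 0"
    then have b: "0 < b" by simp
    \<comment> \<open>The value \<open>t = b / (c + 1)\<close> is small enough for the linear term
      to win; adding 1 avoids a division by zero when \<open>c = 0\<close>.\<close>
    have "- 2 * (b / (c + 1)) * b + (b / (c + 1))\<^sup>2 * c = - (b / (c + 1))\<^sup>2 * (c + 2)"
      using c by (simp add: divide_simps) (simp add: algebra_simps power2_eq_square)
    moreover have "0 < (b / (c + 1))\<^sup>2 * (c + 2)"
      using b c by simp
    ultimately show False
      using ineq[of "b / (c + 1)"] by simp
  qed
  then show ?thesis
    unfolding b_def by (metis inner_eq_zero_iff inner_ge_zero order_antisym)
qed

text \<open>A minimiser of the Rayleigh quotient on the unit sphere of \<open>W\<close> is an eigenvector.\<close>

lemma selfadjoint_eigenvector_in_subspace: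
  fixes f :: "'a::euclidean_space \<Rightarrow> 'a"
  assumes f: "linear f" and sa: "\<And>x y. f x \<bullet> y = x \<bullet> f y"
    and W: "subspace W" "\<And>x. x \<in> W \<Longrightarrow> f x \<in> W"
    and "w \<in> W" "w \<noteq> 0"
  obtains x l where "x \<in> W" "norm x = 1" "f x = l *\<^sub>R x"
proof -
  interpret f: linear f by fact
  let ?S = "W \<inter> sphere 0 1"
  have "compact ?S"
    by (simp add: closed_Int_compact closed_subspace W)
  moreover have "w /\<^sub>R norm w \<in> ?S"
    using assms by (simp add: subspace_scale)
  moreover have "continuous_on ?S (\<lambda>x. x \<bullet> f x)"
    using f by (intro continuous_intros linear_continuous_on) (simp add: linear_conv_bounded_linear)
  ultimately obtain x where x: "x \<in> ?S" and min: "\<And>y. y \<in> ?S \<Longrightarrow> x \<bullet> f x \<le> y \<bullet> f y"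
    using continuous_attains_inf[of ?S "\<lambda>x. x \<bullet> f x"] by blast
  define l where "l = x \<bullet> f x"
  \<comment> \<open>By homogeneity, minimality of \<open>l\<close> on the unit sphere of
    \<open>W\<close> makes the form of \<open>g\<close> nonnegative on all of \<open>W\<close>, and
    it vanishes at \<open>x\<close>. The kernel lemma then turns \<open>x\<close> into an
    eigenvector of \<open>f\<close> for \<open>l\<close>.\<close>
  define g where "g y = f y - l *\<^sub>R y" for y
  have xx: "x \<bullet> x = 1"
    using x by (simp add: dot_square_norm)
  have "g x = 0"
  proof (rule psd_isotropic_in_kernel[of g W])
    show "linear g"
      unfolding g_def by (intro linear_compose_sub f linear_compose_scale_right linear_id[unfolded id_def])
    show "g a \<bullet> b = a \<bullet> g b" for a b
      by (simp add: g_def inner_diff sa)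
    show "g a \<in> W" if "a \<in> W" for a
      using that W by (simp add: g_def subspace_diff subspace_scale)
    show "0 \<le> a \<bullet> g a" if a: "a \<in> W" for a
    proof (cases "a = 0")
      case False
      have "l \<le> (a /\<^sub>R norm a) \<bullet> f (a /\<^sub>R norm a)"
        unfolding l_def using a False W by (intro min) (simp add: subspace_scale)
      then show ?thesis
        using False
        by (simp add: g_def f.scale inner_diff dot_square_norm field_simps power2_eq_square)
    qed simp
    show "x \<bullet> g x = 0"
      by (simp add: g_def inner_diff xx l_def)
  qed (use W x in auto)
  then show thesis
    using that[of x l] x by (simp add: g_def)
qed

text \<open>Induction on \<open>k\<close>: self-adjointness makes the orthogonal complement of the
  eigenvectors found so far invariant under \<open>f\<close>, and for dimension reasons it is
  nonzero, so it contains another unit eigenvector.\<close>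

lemma selfadjoint_orthonormal_eigenvectors:
  fixes f :: "'a::euclidean_space \<Rightarrow> 'a"
  assumes f: "linear f" and sa: "\<And>x y. f x \<bullet> y = x \<bullet> f y"
    and "k \<le> DIM('a)"
  shows "\<exists>B. finite B \<and> card B = k \<and> pairwise orthogonal B \<and>
           (\<forall>b\<in>B. norm b = 1 \<and> (\<exists>l. f b = l *\<^sub>R b))"
  using \<open>k \<le> DIM('a)\<close>
proof (induction k)
  case 0
  then show ?case by (intro exI[of _ "{}"]) simp
next
  case (Suc k)
  then obtain B where B: "finite B" "card B = k" "pairwise orthogonal B"
    "\<And>b. b \<in> B \<Longrightarrow> norm b = 1" "\<And>b. b \<in> B \<Longrightarrow> \<exists>l. f b = l *\<^sub>R b"
    by auto
  let ?W = "{x. \<forall>b\<in>B. orthogonal x b}"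
  have "dim B < DIM('a)"
    using dim_le_card'[OF B(1)] B(2) Suc.prems by linarith
  then obtain w where w: "w \<noteq> 0" "\<And>y. y \<in> span B \<Longrightarrow> orthogonal w y"
    using orthogonal_to_subspace_exists by blast
  have W: "subspace ?W"
    by (auto simp: subspace_def orthogonal_clauses)
  have fW: "f x \<in> ?W" if "x \<in> ?W" for x
    using that B(5) by (fastforce simp: orthogonal_def sa)
  obtain x l where x: "x \<in> ?W" "norm x = 1" "f x = l *\<^sub>R x"
    by (rule selfadjoint_eigenvector_in_subspace[OF f sa W fW, of w]) (use w in \<open>auto intro: span_base\<close>)
  have "x \<notin> B"
    using x by (auto simp: orthogonal_def)
  then show ?case
    using B x by (intro exI[of _ "insert x B"])
      (auto simp: pairwise_insert orthogonal_commute)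
qed

definition diag_matrix :: "('n::finite \<Rightarrow> real) \<Rightarrow> real ^ 'n ^ 'n" where
  "diag_matrix l = (\<chi> i j. if i = j then l i else 0)"

lemma diag_matrix_mult: "diag_matrix l ** diag_matrix m = diag_matrix (\<lambda>i. l i * m i)"
  by (simp add: diag_matrix_def matrix_matrix_mult_def vec_eq_iff mult_delta_left)

lemma diag_matrix_mult_vec: "(diag_matrix l *v x) $ i = l i * x $ i"
  by (simp add: diag_matrix_def matrix_vector_mult_def mult_delta_left)

lemma diag_matrix_const: "diag_matrix (\<lambda>_. c) = mat c"
  by (simp add: diag_matrix_def mat_def)

lemma mat_mult_vec: "mat c *v w = c *\<^sub>R (w :: real ^ 'n)"
  by (simp add: vec_eq_iff diag_matrix_mult_vec flip: diag_matrix_const)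

text \<open>With orthonormal eigenvectors as the columns of \<open>P\<close>, the eigenvalue
  equations become \<open>A ** P = P ** diag_matrix l\<close>; multiplying by
  \<open>transpose P\<close> on the right gives the factorization.\<close>

theorem symmetric_matrix_diagonalization:
  fixes A :: "real ^ 'n ^ 'n"
  assumes "transpose A = A"
  obtains P l where "orthogonal_matrix P" "A = P ** diag_matrix l ** transpose P"
proof -
  have sa: "(A *v x) \<bullet> y = x \<bullet> (A *v y)" for x y
    using assms by (metis dot_lmul_matrix vector_transpose_matrix)
  obtain B where B: "finite B" "card B = CARD('n)" "pairwise orthogonal B"
    "\<And>b. b \<in> B \<Longrightarrow> norm b = 1" "\<And>b. b \<in> B \<Longrightarrow> \<exists>l. A *v b = l *\<^sub>R b"
    using selfadjoint_orthonormal_eigenvectors[of "(*v) A" "CARD('n)"] sa by auto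
  then obtain e where e: "bij_betw e (UNIV :: 'n set) B"
    using finite_same_card_bij[of "UNIV :: 'n set" B] by auto
  then have eB: "e i \<in> B" for i
    by (auto simp: bij_betw_def)
  then obtain l where l: "\<And>i. A *v e i = l i *\<^sub>R e i"
    using B(5)[OF eB] by metis
  define P where "P = (\<chi> i j. e j $ i)"
  have ee: "e i \<bullet> e j = (if i = j then 1 else 0)" for i j
  proof (cases "i = j")
    case True
    then show ?thesis
      using B(4)[OF eB] by (simp add: dot_square_norm)
  next
    case False
    then have "e i \<noteq> e j"
      using e by (simp add: bij_betw_def inj_eq)
    then show ?thesis
      using False B(3) eB by (simp add: pairwise_def orthogonal_def)
  qed
  have P: "orthogonal_matrix P"
    unfolding orthogonal_matrix
    by (simp add: vec_eq_iff matrix_matrix_mult_def transpose_def P_def mat_def ee[unfolded inner_vec_def inner_real_def])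
  have AP: "A ** P = P ** diag_matrix l"
    using l by (simp add: vec_eq_iff matrix_matrix_mult_def matrix_vector_mult_def P_def diag_matrix_def
        mult_delta_right mult.commute)
  have "A = A ** (P ** transpose P)"
    using P by (simp add: orthogonal_matrix_def)
  also have "\<dots> = P ** diag_matrix l ** transpose P"
    by (simp add: matrix_mul_assoc AP)
  finally show thesis
    using that P by blast
qed

section \<open>Trace, determinant, inverse and spectrum of a diagonalized matrix\<close>

lemma trace_diagonalized:
  assumes "orthogonal_matrix P"
  shows "trace (P ** diag_matrix l ** transpose P) = (\<Sum>i\<in>UNIV. l i)"
proof -
  have "trace (P ** diag_matrix l ** transpose P) = trace (transpose P ** P ** diag_matrix l)"
    by (metis trace_mul_sym matrix_mul_assoc)
  then show ?thesis
    using assms by (simp add: orthogonal_matrix_def trace_def diag_matrix_def)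
qed

lemma det_diagonalized:
  assumes "orthogonal_matrix P"
  shows "det (P ** diag_matrix l ** transpose P) = (\<Prod>i\<in>UNIV. l i)"
proof -
  have "det (P ** diag_matrix l ** transpose P) = det (diag_matrix l) * (det P * det (transpose P))"
    by (simp add: det_mul)
  also have "det P * det (transpose P) = 1"
    using assms by (metis det_I det_mul orthogonal_matrix_def)
  finally show ?thesis
    by (simp add: det_diagonal diag_matrix_def)
qed

lemma const_diagonalized:
  assumes "orthogonal_matrix P"
  shows "P ** diag_matrix (\<lambda>_. c) ** transpose P = mat c"
proof -
  have "P ** mat c = mat c ** P"
    by (simp add: vec_eq_iff matrix_matrix_mult_def mat_def mult_delta_left mult_delta_right mult.commute)
  then have "P ** mat c ** transpose P = mat c ** (P ** transpose P)"
    by (simp add: matrix_mul_assoc)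
  then show ?thesis
    using assms by (simp add: diag_matrix_const orthogonal_matrix_def)
qed

text \<open>\<open>matrix_inv\<close> chooses some two-sided inverse. A right inverse of a square
  matrix is also a left inverse, so the choice is not vacuous, and uniqueness of inverses identifies
  it with \<open>B\<close>.\<close>

lemma matrix_inv_eqI:
  fixes A :: "real ^ 'n ^ 'n"
  assumes "A ** B = mat 1"
  shows "matrix_inv A = B"
proof -
  have "B ** A = mat 1"
    using assms by (simp add: matrix_left_right_inverse)
  then have "A ** matrix_inv A = mat 1"
    using assms unfolding matrix_inv_def by (metis (mono_tags, lifting) someI_ex)
  then show ?thesis
    using \<open>B ** A = mat 1\<close> by (metis matrix_mul_assoc matrix_mul_lid matrix_mul_rid)
qed

lemma matrix_inv_diagonalized:
  assumes P: "orthogonal_matrix P" and l: "\<And>i. l i \<noteq> 0"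
  shows "matrix_inv (P ** diag_matrix l ** transpose P)
       = P ** diag_matrix (\<lambda>i. 1 / l i) ** transpose P"
proof (rule matrix_inv_eqI)
  have "P ** diag_matrix l ** transpose P ** (P ** diag_matrix (\<lambda>i. 1 / l i) ** transpose P)
      = P ** diag_matrix l ** (transpose P ** P) ** diag_matrix (\<lambda>i. 1 / l i) ** transpose P"
    by (simp add: matrix_mul_assoc)
  also have "\<dots> = P ** (diag_matrix l ** diag_matrix (\<lambda>i. 1 / l i)) ** transpose P"
    using P by (simp add: orthogonal_matrix_def matrix_mul_assoc)
  also have "\<dots> = mat 1"
    using P l by (simp add: diag_matrix_mult diag_matrix_const orthogonal_matrix_def)
  finally show "P ** diag_matrix l ** transpose P ** (P ** diag_matrix (\<lambda>i. 1 / l i) ** transpose P) = mat 1" .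
qed

text \<open>\<open>P\<close> carries eigenvectors of \<open>A\<close> to eigenvectors of the
  conjugate, and \<open>Q ** P = mat 1\<close> keeps them nonzero. Using the lemma again with
  \<open>P\<close> and \<open>Q\<close> exchanged shows that conjugation by an orthogonal matrix
  preserves the spectrum.\<close>

lemma is_eigenvalue_conjugate:
  assumes "Q ** P = mat 1" and "is_eigenvalue A m"
  shows "is_eigenvalue (P ** A ** Q) m"
proof -
  obtain y where y: "y \<noteq> 0" "A *v y = m *\<^sub>R y"
    using assms(2) by (auto simp: is_eigenvalue_def)
  have QP: "Q *v (P *v y) = y"
    using assms(1) by (simp add: matrix_vector_mul_assoc)
  have "P ** A ** Q *v (P *v y) = P *v (A *v (Q *v (P *v y)))"
    by (simp flip: matrix_vector_mul_assoc)
  also have "\<dots> = m *\<^sub>R (P *v y)"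
    by (simp add: QP y matrix_vector_mult_scaleR)
  finally have "P ** A ** Q *v (P *v y) = m *\<^sub>R (P *v y)" .
  moreover have "P *v y \<noteq> 0"
    using QP y(1) by force
  ultimately show ?thesis
    unfolding is_eigenvalue_def by blast
qed

lemma is_eigenvalue_diag_matrix: "is_eigenvalue (diag_matrix l) m \<longleftrightarrow> m \<in> range l"
proof
  assume "is_eigenvalue (diag_matrix l) m"
  then obtain x where x: "x \<noteq> 0" "diag_matrix l *v x = m *\<^sub>R x"
    by (auto simp: is_eigenvalue_def)
  then obtain i where "x $ i \<noteq> 0"
    by (auto simp: vec_eq_iff)
  moreover have "l i * x $ i = m * x $ i"
    using arg_cong[OF x(2), of "\<lambda>x. x $ i"] by (simp add: diag_matrix_mult_vec)
  ultimately show "m \<in> range l"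
    by auto
next
  assume "m \<in> range l"
  then obtain i where "m = l i" by blast
  then show "is_eigenvalue (diag_matrix l) m"
    unfolding is_eigenvalue_def
    by (intro exI[of _ "axis i 1"])
       (auto simp: vec_eq_iff diag_matrix_mult_vec axis_def)
qed

lemma is_eigenvalue_diagonalized:
  assumes P: "orthogonal_matrix P"
  shows "is_eigenvalue (P ** diag_matrix l ** transpose P) m \<longleftrightarrow> m \<in> range l"
proof -
  let ?A = "P ** diag_matrix l ** transpose P"
  have PP: "transpose P ** P = mat 1" "P ** transpose P = mat 1"
    using P by (auto simp: orthogonal_matrix_def)
  have "transpose P ** ?A ** P = transpose P ** P ** diag_matrix l ** (transpose P ** P)"
    by (simp only: matrix_mul_assoc)
  then have "transpose P ** ?A ** P = diag_matrix l"
    by (simp add: PP)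
  then have "is_eigenvalue ?A m \<longleftrightarrow> is_eigenvalue (diag_matrix l) m"
    using is_eigenvalue_conjugate[OF PP(1), of "diag_matrix l" m]
      is_eigenvalue_conjugate[OF PP(2), of ?A m] by auto
  then show ?thesis
    by (simp add: is_eigenvalue_diag_matrix)
qed

text \<open>The eigenvalues form the finite nonempty set \<open>range l\<close>, so the
  \<open>LEAST\<close> in \<open>lambda_min\<close> is attained.\<close>

lemma lambda_min_diagonalized:
  assumes P: "orthogonal_matrix P"
  shows "lambda_min (P ** diag_matrix l ** transpose P) = Min (range l)"
  unfolding lambda_min_def is_eigenvalue_diagonalized[OF P]
  by (rule Least_equality) auto

subsection \<open>The frame matrix\<close>

lemma frame_matrix_component: "frame_matrix K v $ i $ j = (\<Sum>k = 1..K. v k $ i * v k $ j)"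
  by (simp add: frame_matrix_def frame_operator_def matrix_def inner_axis' mult.commute)

lemma transpose_frame_matrix: "transpose (frame_matrix K v) = frame_matrix K v"
  by (simp add: vec_eq_iff transpose_def frame_matrix_component mult.commute)

text \<open>This is how the norm constraints reach the spectrum: on feasible sequences the sum of
  the eigenvalues is the fixed sum of the \<open>\<alpha> i\<close>.\<close>

lemma trace_frame_matrix: "trace (frame_matrix K v) = (\<Sum>k = 1..K. v k \<bullet> v k)"
  unfolding trace_def frame_matrix_component inner_vec_def inner_real_def by (rule sum.swap)

lemma linear_frame_operator: "linear (frame_operator K v)"
  unfolding frame_operator_def
  by (rule linearI) (simp_all add: inner_add_left scaleR_add_left sum.distrib scaleR_sum_right)

lemma frame_matrix_mult_vec: "frame_matrix K v *v w = frame_operator K v w"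
  by (simp add: frame_matrix_def matrix_works linear_frame_operator)

lemma inner_frame_operator: "w \<bullet> frame_operator K v w = (\<Sum>i = 1..K. (w \<bullet> v i)\<^sup>2)"
  by (simp add: frame_operator_def inner_sum_right power2_eq_square)

text \<open>The form is a sum of squares. If it vanishes, \<open>w\<close> is orthogonal to every
  frame vector, hence to their span, which contains \<open>w\<close> itself.\<close>

lemma frame_operator_pos:
  assumes "is_frame K v" "w \<noteq> 0"
  shows "0 < w \<bullet> frame_operator K v w"
proof (rule ccontr)
  assume "\<not> ?thesis"
  then have "(\<Sum>i = 1..K. (w \<bullet> v i)\<^sup>2) = 0"
    unfolding inner_frame_operator by (meson antisym not_less sum_nonneg zero_le_power2)
  then have "\<And>i. i \<in> {1..K} \<Longrightarrow> orthogonal w (v i)"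
    by (subst (asm) sum_nonneg_eq_0_iff) (auto simp: orthogonal_def)
  then have "orthogonal w w"
    using assms(1) by (intro orthogonal_to_span[of w "v ` {1..K}"]) (auto simp: is_frame_def)
  with \<open>w \<noteq> 0\<close> show False by (simp add: orthogonal_self)
qed

text \<open>Values of the frame operator lie in the span of the vectors, and here every
  \<open>w\<close> is a multiple of such a value. This supplies the spanning constraint for the
  tight frame constructed below.\<close>

lemma is_frame_if_frame_operator_scale:
  assumes "c \<noteq> 0" "\<And>w. frame_operator K v w = c *\<^sub>R w"
  shows "is_frame K v"
proof -
  have "w \<in> span (v ` {1..K})" for w
  proof -
    have "frame_operator K v w \<in> span (v ` {1..K})"
      unfolding frame_operator_def by (intro span_sum span_scale span_base) auto
    then have "inverse c *\<^sub>R (c *\<^sub>R w) \<in> span (v ` {1..K})"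
      unfolding assms(2) by (rule span_scale)
    then show ?thesis
      using assms(1) by simp
  qed
  then show ?thesis
    by (auto simp: is_frame_def)
qed

text \<open>The sum in the tightness condition is the quadratic form of the frame operator.
  Evaluating the condition at eigenvectors forces every eigenvalue to be \<open>a\<close>, and a
  diagonalizable matrix with the single eigenvalue \<open>a\<close> is \<open>mat a\<close>.\<close>

lemma is_tight_frame_iff_frame_matrix:
  assumes "is_frame K v"
  shows "is_tight_frame K v \<longleftrightarrow> (\<exists>a>0. frame_matrix K v = mat a)"
proof -
  have "(\<forall>w. a * (norm w)\<^sup>2 = (\<Sum>i = 1..K. \<bar>w \<bullet> v i\<bar>\<^sup>2)) \<longleftrightarrow> frame_matrix K v = mat a" for a
  proof
    assume a: "\<forall>w. a * (norm w)\<^sup>2 = (\<Sum>i = 1..K. \<bar>w \<bullet> v i\<bar>\<^sup>2)"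
    obtain P l where P: "orthogonal_matrix P" "frame_matrix K v = P ** diag_matrix l ** transpose P"
      using symmetric_matrix_diagonalization[OF transpose_frame_matrix] by metis
    have "l i = a" for i
    proof -
      have "is_eigenvalue (frame_matrix K v) (l i)"
        using P by (simp add: is_eigenvalue_diagonalized)
      then obtain x where x: "x \<noteq> 0" "frame_operator K v x = l i *\<^sub>R x"
        by (auto simp: is_eigenvalue_def frame_matrix_mult_vec)
      have "a * (x \<bullet> x) = x \<bullet> frame_operator K v x"
        using a by (simp add: inner_frame_operator dot_square_norm)
      then show ?thesis
        using x by simp
    qed
    then have "l = (\<lambda>_. a)" by blast
    then show "frame_matrix K v = mat a"
      using P by (simp add: const_diagonalized)
  next
    assume "frame_matrix K v = mat a"
    then have "frame_operator K v w = a *\<^sub>R w" for w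
      by (simp add: mat_mult_vec flip: frame_matrix_mult_vec)
    then have "a * (w \<bullet> w) = (\<Sum>i = 1..K. (w \<bullet> v i)\<^sup>2)" for w
      using inner_frame_operator[of w K v] by simp
    then show "\<forall>w. a * (norm w)\<^sup>2 = (\<Sum>i = 1..K. \<bar>w \<bullet> v i\<bar>\<^sup>2)"
      by (simp add: dot_square_norm)
  qed
  with assms show ?thesis
    by (simp add: is_tight_frame_def)
qed

subsection \<open>Tight frames with prescribed norms\<close>

text \<open>Rotating the pair by an angle from 0 to \<open>pi / 2\<close> moves the squared norm of
  the first vector continuously from \<open>a \<bullet> a\<close> to \<open>b \<bullet> b\<close>,
  so it takes the value \<open>t\<close>. In both conserved quantities the mixed terms
  cancel.\<close>

lemma rotate_to_norm:
  fixes a b :: "'a::real_inner"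
  assumes "a \<bullet> a \<le> t \<and> t \<le> b \<bullet> b \<or> b \<bullet> b \<le> t \<and> t \<le> a \<bullet> a"
  obtains a' b' where "a' \<bullet> a' = t" "b' \<bullet> b' = a \<bullet> a + b \<bullet> b - t"
    "\<And>w. (w \<bullet> a') *\<^sub>R a' + (w \<bullet> b') *\<^sub>R b' = (w \<bullet> a) *\<^sub>R a + (w \<bullet> b) *\<^sub>R b"
proof -
  define f where "f \<theta> = (cos \<theta> *\<^sub>R a + sin \<theta> *\<^sub>R b) \<bullet> (cos \<theta> *\<^sub>R a + sin \<theta> *\<^sub>R b)" for \<theta> :: real
  have f: "f 0 = a \<bullet> a" "f (pi / 2) = b \<bullet> b"
    by (simp_all add: f_def)
  have cont: "continuous_on {0..pi / 2} f"
    unfolding f_def by (intro continuous_intros)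
  have "\<exists>\<theta>. 0 \<le> \<theta> \<and> \<theta> \<le> pi / 2 \<and> f \<theta> = t"
    using assms IVT'[of f 0 t "pi / 2", OF _ _ _ cont] IVT2'[of f "pi / 2" t 0, OF _ _ _ cont]
    by (auto simp: f)
  then obtain \<theta> where \<theta>: "f \<theta> = t" by blast
  define c s where "c = cos \<theta>" and "s = sin \<theta>"
  have cs: "s * s = 1 - c * c"
    by (simp add: c_def s_def) (metis add_diff_cancel_left' power2_eq_square sin_cos_squared_add2)
  let ?a = "c *\<^sub>R a + s *\<^sub>R b" and ?b = "c *\<^sub>R b - s *\<^sub>R a"
  have a: "?a \<bullet> ?a = t"
    using \<theta> by (simp add: f_def c_def s_def)
  have "?a \<bullet> ?a + ?b \<bullet> ?b = (c * c + s * s) * (a \<bullet> a) + (c * c + s * s) * (b \<bullet> b)"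
    by (simp add: inner_add inner_diff inner_commute algebra_simps)
  then have "?b \<bullet> ?b = a \<bullet> a + b \<bullet> b - t"
    using a cs by simp
  moreover have "(w \<bullet> ?a) *\<^sub>R ?a + (w \<bullet> ?b) *\<^sub>R ?b = (w \<bullet> a) *\<^sub>R a + (w \<bullet> b) *\<^sub>R b" for w
  proof -
    have "(w \<bullet> ?a) *\<^sub>R ?a + (w \<bullet> ?b) *\<^sub>R ?b
        = ((c * c + s * s) * (w \<bullet> a)) *\<^sub>R a + ((c * c + s * s) * (w \<bullet> b)) *\<^sub>R b"
      by (simp add: inner_add inner_diff algebra_simps)
    then show ?thesis
      by (simp add: cs)
  qed
  ultimately show thesis
    using that a by blast
qed

text \<open>The exceptional index \<open>k\<close> keeps the induction going: its norm is corrected by a rotation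
  against some \<open>j\<close> on the opposite side of its target, whose squared norm is necessarily an
  endpoint of \<open>[0, c]\<close>; afterwards \<open>k\<close> is dropped and \<open>j\<close> becomes exceptional.\<close>

lemma prescribe_norms:
  fixes u :: "'i \<Rightarrow> 'a::real_inner" and \<alpha> :: "'i \<Rightarrow> real"
  assumes "finite I" and "k \<in> I"
    and "\<And>i. i \<in> I \<Longrightarrow> 0 \<le> \<alpha> i \<and> \<alpha> i \<le> c"
    and "\<And>i. i \<in> I \<Longrightarrow> i \<noteq> k \<Longrightarrow> u i \<bullet> u i \<in> {0, c}"
    and "u k \<bullet> u k \<le> c"
    and "(\<Sum>i\<in>I. \<alpha> i) = (\<Sum>i\<in>I. u i \<bullet> u i)"
  shows "\<exists>v. (\<forall>i\<in>I. v i \<bullet> v i = \<alpha> i) \<and>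
             (\<forall>w. (\<Sum>i\<in>I. (w \<bullet> v i) *\<^sub>R v i) = (\<Sum>i\<in>I. (w \<bullet> u i) *\<^sub>R u i))"
  using assms
proof (induction "card I" arbitrary: I k u)
  case 0
  then show ?case by auto
next
  case (Suc m)
  let ?J = "I - {k}"
  have sumI: "(\<Sum>i\<in>I. h i) = h k + (\<Sum>i\<in>?J. h i)" for h :: "'i \<Rightarrow> real"
    using Suc.prems by (simp add: sum.remove)
  have sumI': "(\<Sum>i\<in>I. h i) = h k + (\<Sum>i\<in>?J. h i)" for h :: "'i \<Rightarrow> 'a"
    using Suc.prems by (simp add: sum.remove)
  have cardJ: "m = card ?J"
    using Suc by simp
  show ?case
  proof (cases "?J = {}")
    case True
    then have "I = {k}" using Suc.prems by auto
    \<comment> \<open>With one index left, equality of the two sums is already the norm condition,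
      so \<open>u\<close> itself serves.\<close>
    then show ?thesis
      using Suc.prems by (intro exI[of _ u]) auto
  next
    case False
    \<comment> \<open>Otherwise all other squared norms lie strictly on the same side of
      \<open>\<alpha> k\<close> as that of \<open>u k\<close>. Being 0 or \<open>c\<close>, they are
      then all 0 (below their targets) or all \<open>c\<close> (above them), which contradicts
      equality of the sums. If \<open>u k\<close> is already correct, any \<open>j\<close>
      works.\<close>
    have "\<exists>j\<in>?J. u k \<bullet> u k \<le> \<alpha> k \<and> \<alpha> k \<le> u j \<bullet> u j \<or> u j \<bullet> u j \<le> \<alpha> k \<and> \<alpha> k \<le> u k \<bullet> u k"
    proof (rule ccontr)
      assume no: "\<not> ?thesis"
      consider "u k \<bullet> u k = \<alpha> k" | "u k \<bullet> u k < \<alpha> k" | "\<alpha> k < u k \<bullet> u k" by linarith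
      then show False
      proof cases
        case 1
        then show False using no False by force
      next
        case 2
        have "(\<Sum>i\<in>?J. u i \<bullet> u i) \<le> (\<Sum>i\<in>?J. \<alpha> i)"
          using Suc.prems 2 no by (intro sum_mono) fastforce
        then show False
          using 2 Suc.prems(6) sumI[of \<alpha>] sumI[of "\<lambda>i. u i \<bullet> u i"] by linarith
      next
        case 3
        have "(\<Sum>i\<in>?J. \<alpha> i) \<le> (\<Sum>i\<in>?J. u i \<bullet> u i)"
        proof (rule sum_mono)
          fix i assume i: "i \<in> ?J"
          then have "\<alpha> k < u i \<bullet> u i"
            using no 3 by force
          then have "u i \<bullet> u i = c"
            using Suc.prems(3)[OF Suc.prems(2)] Suc.prems(4)[of i] i by auto
          then show "\<alpha> i \<le> u i \<bullet> u i"
            using Suc.prems(3) i by auto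
        qed
        then show False
          using 3 Suc.prems(6) sumI[of \<alpha>] sumI[of "\<lambda>i. u i \<bullet> u i"] by linarith
      qed
    qed
    then obtain j where j: "j \<in> ?J" and
      jk: "u k \<bullet> u k \<le> \<alpha> k \<and> \<alpha> k \<le> u j \<bullet> u j \<or> u j \<bullet> u j \<le> \<alpha> k \<and> \<alpha> k \<le> u k \<bullet> u k"
      by blast
    obtain a b where a: "a \<bullet> a = \<alpha> k" and b: "b \<bullet> b = u k \<bullet> u k + u j \<bullet> u j - \<alpha> k" and
      ab: "\<And>w. (w \<bullet> a) *\<^sub>R a + (w \<bullet> b) *\<^sub>R b = (w \<bullet> u k) *\<^sub>R u k + (w \<bullet> u j) *\<^sub>R u j"
      using rotate_to_norm[OF jk] by metis
    define u' where "u' = u(j := b)"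
    let ?L = "?J - {j}"
    have sumJ: "(\<Sum>i\<in>?J. h i) = h j + (\<Sum>i\<in>?L. h i)" for h :: "'i \<Rightarrow> real"
      using Suc.prems j by (simp add: sum.remove)
    have sumJ': "(\<Sum>i\<in>?J. h i) = h j + (\<Sum>i\<in>?L. h i)" for h :: "'i \<Rightarrow> 'a"
      using Suc.prems j by (simp add: sum.remove)
    have u'L: "(\<Sum>i\<in>?L. u' i \<bullet> u' i) = (\<Sum>i\<in>?L. u i \<bullet> u i)"
      "(\<Sum>i\<in>?L. (w \<bullet> u' i) *\<^sub>R u' i) = (\<Sum>i\<in>?L. (w \<bullet> u i) *\<^sub>R u i)" for w
      by (auto simp: u'_def intro!: sum.cong)
    have "\<exists>v. (\<forall>i\<in>?J. v i \<bullet> v i = \<alpha> i) \<and>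
             (\<forall>w. (\<Sum>i\<in>?J. (w \<bullet> v i) *\<^sub>R v i) = (\<Sum>i\<in>?J. (w \<bullet> u' i) *\<^sub>R u' i))"
    proof (rule Suc.hyps(1)[OF cardJ _ j])
      show "u' i \<bullet> u' i \<in> {0, c}" if "i \<in> ?J" "i \<noteq> j" for i
        using that Suc.prems(4) by (auto simp: u'_def)
      \<comment> \<open>Since \<open>\<alpha> k\<close> lies between the squared norms of
        \<open>u k\<close> and \<open>u j\<close>, so does their sum minus
        \<open>\<alpha> k\<close>; both are at most \<open>c\<close>.\<close>
      have "u j \<bullet> u j \<in> {0, c}"
        using j Suc.prems(4) by blast
      then show "u' j \<bullet> u' j \<le> c"
        using jk Suc.prems(2,3,5) by (fastforce simp: u'_def b)
      show "(\<Sum>i\<in>?J. \<alpha> i) = (\<Sum>i\<in>?J. u' i \<bullet> u' i)"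
        using Suc.prems(6) unfolding sumI sumJ u'L by (simp add: u'_def b)
    qed (use Suc.prems in auto)
    then obtain v where v: "\<And>i. i \<in> ?J \<Longrightarrow> v i \<bullet> v i = \<alpha> i"
      "\<And>w. (\<Sum>i\<in>?J. (w \<bullet> v i) *\<^sub>R v i) = (\<Sum>i\<in>?J. (w \<bullet> u' i) *\<^sub>R u' i)"
      by blast
    define v' where "v' = v(k := a)"
    have "(\<Sum>i\<in>I. (w \<bullet> v' i) *\<^sub>R v' i) = (\<Sum>i\<in>I. (w \<bullet> u i) *\<^sub>R u i)" for w
    proof -
      have "(\<Sum>i\<in>I. (w \<bullet> v' i) *\<^sub>R v' i) = (w \<bullet> a) *\<^sub>R a + (\<Sum>i\<in>?J. (w \<bullet> v i) *\<^sub>R v i)"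
        unfolding sumI' by (auto simp: v'_def intro!: sum.cong)
      also have "\<dots> = (w \<bullet> a) *\<^sub>R a + (w \<bullet> b) *\<^sub>R b + (\<Sum>i\<in>?L. (w \<bullet> u i) *\<^sub>R u i)"
        unfolding v(2) sumJ' u'L by (simp add: u'_def)
      also have "\<dots> = (\<Sum>i\<in>I. (w \<bullet> u i) *\<^sub>R u i)"
        unfolding ab sumI' sumJ' by simp
      finally show ?thesis .
    qed
    then show ?thesis
      using v(1) a by (intro exI[of _ v']) (auto simp: v'_def)
  qed
qed

lemma tight_frame_exists:
  fixes \<alpha> :: "nat \<Rightarrow> real"
  assumes \<alpha>: "\<And>i. i \<in> {1..K} \<Longrightarrow> 0 \<le> \<alpha> i \<and> \<alpha> i \<le> c"
    and c: "0 < c" "(\<Sum>i = 1..K. \<alpha> i) = real CARD('n) * c"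
  shows "\<exists>v :: nat \<Rightarrow> real ^ 'n. feasible K \<alpha> v \<and> frame_matrix K v = mat c"
proof -
  \<comment> \<open>No target exceeds \<open>c\<close> but they add up to \<open>n\<close> times
    \<open>c\<close>, so there are at least \<open>n\<close> indices to carry a scaled
    basis.\<close>
  have "(\<Sum>i = 1..K. \<alpha> i) \<le> (\<Sum>i = 1..K. c)"
    using \<alpha> by (intro sum_mono) auto
  then have nK: "CARD('n) \<le> K"
    using c by simp
  then obtain S where S: "S \<subseteq> {1..K}" "card S = CARD('n)" "finite S"
    using obtain_subset_with_card_n[of "CARD('n)" "{1..K}"] by auto
  then obtain e where e: "bij_betw e S (UNIV :: 'n set)"
    using finite_same_card_bij[of S "UNIV :: 'n set"] by auto
  define u where "u i = (if i \<in> S then sqrt c *\<^sub>R axis (e i) 1 else (0 :: real ^ 'n))" for i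
  have uu: "u i \<bullet> u i = (if i \<in> S then c else 0)" for i
    using c by (simp add: u_def inner_axis_axis)
  have "(\<Sum>i = 1..K. (w \<bullet> u i) *\<^sub>R u i) = c *\<^sub>R w" for w
  proof -
    have "(\<Sum>i = 1..K. (w \<bullet> u i) *\<^sub>R u i) = (\<Sum>i\<in>S. (w \<bullet> u i) *\<^sub>R u i)"
      using S by (intro sum.mono_neutral_right) (auto simp: u_def)
    also have "\<dots> = (\<Sum>i\<in>S. c *\<^sub>R ((w $ e i) *\<^sub>R axis (e i) 1))"
      using c by (intro sum.cong) (auto simp: u_def inner_axis)
    also have "\<dots> = c *\<^sub>R (\<Sum>j\<in>UNIV. (w $ j) *\<^sub>R axis j 1)"
      unfolding scaleR_sum_right by (rule sum.reindex_bij_betw[OF e])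
    also have "(\<Sum>j\<in>UNIV. (w $ j) *\<^sub>R axis j 1) = w"
      using basis_expansion[of w] by (simp add: scalar_mult_eq_scaleR)
    finally show ?thesis .
  qed
  moreover have "\<exists>v. (\<forall>i\<in>{1..K}. v i \<bullet> v i = \<alpha> i) \<and>
      (\<forall>w. (\<Sum>i = 1..K. (w \<bullet> v i) *\<^sub>R v i) = (\<Sum>i = 1..K. (w \<bullet> u i) *\<^sub>R u i))"
  \<comment> \<open>All squared norms of \<open>u\<close> are 0 or \<open>c\<close>, so any index
    may start as the exceptional one.\<close>
  proof (rule prescribe_norms[where k = 1 and c = c])
    show "1 \<in> {1..K}"
      using nK zero_less_card_finite[where 'a = 'n] by (simp del: zero_less_card_finite)
    have "(\<Sum>i = 1..K. u i \<bullet> u i) = real CARD('n) * c"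
      using S by (simp add: uu sum.If_cases Int_absorb1)
    then show "(\<Sum>i = 1..K. \<alpha> i) = (\<Sum>i = 1..K. u i \<bullet> u i)"
      using c by simp
  qed (use \<alpha> c in \<open>auto simp: uu\<close>)
  ultimately obtain v :: "nat \<Rightarrow> real ^ 'n" where
    v: "\<And>i. i \<in> {1..K} \<Longrightarrow> v i \<bullet> v i = \<alpha> i" "\<And>w. frame_operator K v w = c *\<^sub>R w"
    unfolding frame_operator_def by metis
  have "is_frame K v"
    using is_frame_if_frame_operator_scale[of c K v] c v by auto
  moreover have "frame_matrix K v = mat c"
    by (simp add: matrix_eq frame_matrix_mult_vec v(2) mat_mult_vec)
  ultimately show ?thesis
    using v(1) unfolding feasible_def is_frame_def by blast
qed

subsection \<open>Extremal spectra\<close>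

text \<open>The inequality between harmonic and arithmetic mean. The gap between the two sides is
  exactly the sum of the nonnegative terms \<open>(l i - c)\<^sup>2 / (l i * c\<^sup>2)\<close>,
  which settles the equality case as well.\<close>

lemma sum_inverse_ge_mean:
  fixes l :: "'a::finite \<Rightarrow> real"
  assumes l: "\<And>i. 0 < l i" and c: "0 < c" "(\<Sum>i\<in>UNIV. l i) = real CARD('a) * c"
  shows "real CARD('a) / c \<le> (\<Sum>i\<in>UNIV. 1 / l i)"
    and "(\<Sum>i\<in>UNIV. 1 / l i) = real CARD('a) / c \<longleftrightarrow> (\<forall>i. l i = c)"
proof -
  have "(\<Sum>i\<in>UNIV. (l i - c)\<^sup>2 / (l i * c\<^sup>2)) = (\<Sum>i\<in>UNIV. 1 / l i - 2 / c + l i / c\<^sup>2)"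
  proof (rule sum.cong)
    show "(l i - c)\<^sup>2 / (l i * c\<^sup>2) = 1 / l i - 2 / c + l i / c\<^sup>2" for i
      using l[of i] c(1) by (simp add: divide_simps) (simp add: power2_eq_square algebra_simps)
  qed simp
  also have "\<dots> = (\<Sum>i\<in>UNIV. 1 / l i) - real CARD('a) * (2 / c) + (real CARD('a) * c) / c\<^sup>2"
    by (simp add: sum.distrib sum_subtractf c(2) flip: sum_divide_distrib)
  also have "\<dots> = (\<Sum>i\<in>UNIV. 1 / l i) - real CARD('a) / c"
    using c(1) by (simp add: field_simps power2_eq_square)
  finally have eq: "(\<Sum>i\<in>UNIV. (l i - c)\<^sup>2 / (l i * c\<^sup>2)) = (\<Sum>i\<in>UNIV. 1 / l i) - real CARD('a) / c" .
  have nn: "0 \<le> (l i - c)\<^sup>2 / (l i * c\<^sup>2)" for i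
    using l[of i] by simp
  then show "real CARD('a) / c \<le> (\<Sum>i\<in>UNIV. 1 / l i)"
    using eq sum_nonneg[of UNIV "\<lambda>i. (l i - c)\<^sup>2 / (l i * c\<^sup>2)"] by simp
  have "(\<Sum>i\<in>UNIV. 1 / l i) = real CARD('a) / c \<longleftrightarrow> (\<Sum>i\<in>UNIV. (l i - c)\<^sup>2 / (l i * c\<^sup>2)) = 0"
    using eq by auto
  also have "\<dots> \<longleftrightarrow> (\<forall>i. (l i - c)\<^sup>2 / (l i * c\<^sup>2) = 0)"
    using nn by (subst sum_nonneg_eq_0_iff) auto
  also have "\<dots> \<longleftrightarrow> (\<forall>i. l i = c)"
    using l c(1) by (auto simp: less_imp_neq[THEN not_sym])
  finally show "(\<Sum>i\<in>UNIV. 1 / l i) = real CARD('a) / c \<longleftrightarrow> (\<forall>i. l i = c)" .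
qed

text \<open>The nonnegative deviations from the minimum \<open>m\<close> add up to
  \<open>real CARD('a) * (c - m)\<close>; this is zero only if each of them is.\<close>

lemma Min_le_mean:
  fixes l :: "'a::finite \<Rightarrow> real"
  assumes c: "(\<Sum>i\<in>UNIV. l i) = real CARD('a) * c"
  shows "Min (range l) \<le> c"
    and "Min (range l) = c \<longleftrightarrow> (\<forall>i. l i = c)"
proof -
  define m where "m = Min (range l)"
  have m: "0 \<le> l i - m" for i
    by (simp add: m_def)
  have eq: "(\<Sum>i\<in>UNIV. l i - m) = real CARD('a) * (c - m)"
    by (simp add: sum_subtractf c algebra_simps)
  moreover have "0 \<le> (\<Sum>i\<in>UNIV. l i - m)"
    using m by (rule sum_nonneg)
  ultimately show "Min (range l) \<le> c"
    unfolding m_def by (simp add: zero_le_mult_iff)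
  show "Min (range l) = c \<longleftrightarrow> (\<forall>i. l i = c)"
  proof
    assume "Min (range l) = c"
    then have "(\<Sum>i\<in>UNIV. l i - m) = 0" and "m = c"
      using eq by (auto simp: m_def)
    then show "\<forall>i. l i = c"
      using m by (subst (asm) sum_nonneg_eq_0_iff) auto
  next
    assume "\<forall>i. l i = c"
    then have "range l = {c}" by auto
    then show "Min (range l) = c" by simp
  qed
qed

text \<open>The inequality between geometric and arithmetic mean, from
  \<open>ln x \<le> x - 1\<close> at \<open>x = l i / c\<close>, with equality only at
  \<open>x = 1\<close>. The terms \<open>l i / c - 1\<close> sum to zero, so only the logarithms
  remain.\<close>

lemma prod_le_mean_power:
  fixes l :: "'a::finite \<Rightarrow> real"
  assumes l: "\<And>i. 0 < l i" and c: "0 < c" "(\<Sum>i\<in>UNIV. l i) = real CARD('a) * c"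
  shows "(\<Prod>i\<in>UNIV. l i) \<le> c ^ CARD('a)"
    and "(\<Prod>i\<in>UNIV. l i) = c ^ CARD('a) \<longleftrightarrow> (\<forall>i. l i = c)"
proof -
  let ?d = "\<lambda>i. l i / c - 1 - ln (l i / c)"
  have prod: "0 < (\<Prod>i\<in>UNIV. l i)"
    using l by (simp add: prod_pos)
  have "(\<Sum>i\<in>UNIV. ?d i) = (\<Sum>i\<in>UNIV. l i / c - 1) - (\<Sum>i\<in>UNIV. ln (l i) - ln c)"
    unfolding sum_subtractf[symmetric]
    using l c(1) by (intro sum.cong) (auto simp: ln_divide_pos)
  also have "\<dots> = ln (c ^ CARD('a)) - ln (\<Prod>i\<in>UNIV. l i)"
    using l c by (simp add: sum_subtractf ln_prod ln_realpow less_imp_neq[THEN not_sym] flip: sum_divide_distrib)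
  finally have eq: "(\<Sum>i\<in>UNIV. ?d i) = ln (c ^ CARD('a)) - ln (\<Prod>i\<in>UNIV. l i)" .
  have nn: "0 \<le> ?d i" for i
    using ln_le_minus_one[of "l i / c"] l[of i] c(1) by simp
  then have "ln (\<Prod>i\<in>UNIV. l i) \<le> ln (c ^ CARD('a))"
    using eq sum_nonneg[of UNIV ?d] by simp
  then show "(\<Prod>i\<in>UNIV. l i) \<le> c ^ CARD('a)"
    using prod c(1) by simp
  have "(\<Prod>i\<in>UNIV. l i) = c ^ CARD('a) \<longleftrightarrow> (\<Sum>i\<in>UNIV. ?d i) = 0"
    unfolding eq using prod c(1) by auto
  also have "\<dots> \<longleftrightarrow> (\<forall>i. ?d i = 0)"
    using nn by (subst sum_nonneg_eq_0_iff) auto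
  also have "\<dots> \<longleftrightarrow> (\<forall>i. l i = c)"
  proof -
    have "?d i = 0 \<longleftrightarrow> l i = c" for i
      using ln_eq_minus_one[of "l i / c"] l[of i] c(1) by (auto simp: field_simps)
    then show ?thesis by simp
  qed
  finally show "(\<Prod>i\<in>UNIV. l i) = c ^ CARD('a) \<longleftrightarrow> (\<forall>i. l i = c)" .
qed

section \<open>From sharp bounds to optimal solutions\<close>

text \<open>Existence of a feasible point with \<open>Q\<close> shows that the bound
  \<open>m\<close> is attained, so being a minimiser amounts to having value \<open>m\<close>. For
  \<open>Q\<close> being tightness, this is where a tight frame must be known to exist.\<close>

lemma is_arg_min_iff_attains_bound:
  fixes f :: "'a \<Rightarrow> real"
  assumes bound: "\<And>u. P u \<Longrightarrow> m \<le> f u" and att: "\<And>u. P u \<Longrightarrow> f u = m \<longleftrightarrow> Q u"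
    and ex: "\<exists>u. P u \<and> Q u" and "P v"
  shows "is_arg_min f P v \<longleftrightarrow> Q v"
proof -
  obtain u where "P u" "f u = m"
    using att ex by blast
  with assms(4) bound[of v] have "is_arg_min f P v \<longleftrightarrow> f v = m"
    unfolding is_arg_min_def using bound by fastforce
  then show ?thesis
    using att \<open>P v\<close> by simp
qed

lemma is_arg_max_iff_is_arg_min_uminus:
  fixes f :: "'a \<Rightarrow> real"
  shows "is_arg_max f P v \<longleftrightarrow> is_arg_min (\<lambda>u. - f u) P v"
  by (simp add: is_arg_max_def is_arg_min_def)

theorem theorem8:
  fixes K :: nat and \<alpha> :: "nat \<Rightarrow> real" and v :: "nat \<Rightarrow> real ^ 'n"
  assumes "K \<ge> 1"
    and "\<And>i. i \<in> {1..K} \<Longrightarrow> \<alpha> i > 0"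
    and "\<And>i j. 1 \<le> i \<Longrightarrow> i \<le> j \<Longrightarrow> j \<le> K \<Longrightarrow> \<alpha> j \<le> \<alpha> i"
    and "\<alpha> 1 \<le> 1 / real CARD('n) * (\<Sum>i = 1..K. \<alpha> i)"
    and "feasible K \<alpha> v"
  shows "(is_arg_min (\<lambda>u. trace (matrix_inv (frame_matrix K u))) (feasible K \<alpha>) v
            \<longleftrightarrow> is_tight_frame K v)
       \<and> (is_arg_min (\<lambda>u. 1 / lambda_min (frame_matrix K u)) (feasible K \<alpha>) v
            \<longleftrightarrow> is_tight_frame K v)
       \<and> (is_arg_max (\<lambda>u. det (frame_matrix K u)) (feasible K \<alpha>) v
            \<longleftrightarrow> is_tight_frame K v)"
proof -
  define n where "n = real CARD('n)"
  \<comment> \<open>The mean of the eigenvalues of every feasible frame operator, hence the only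
    possible tight frame constant.\<close>
  define c where "c = (\<Sum>i = 1..K. \<alpha> i) / n"
  have n: "0 < n" by (simp add: n_def)
  have sum_pos: "0 < (\<Sum>i = 1..K. \<alpha> i)"
    using assms(1,2) by (intro sum_pos) auto
  then have c: "0 < c"
    using n by (simp add: c_def)
  have nc: "(\<Sum>i = 1..K. \<alpha> i) = n * c"
    using n by (simp add: c_def)
  have trace: "trace (frame_matrix K u) = n * c" if "feasible K \<alpha> u" for u :: "nat \<Rightarrow> real ^ 'n"
    using that by (simp add: trace_frame_matrix feasible_def flip: nc)
  have spectrum: "\<exists>P l. orthogonal_matrix P \<and> frame_matrix K u = P ** diag_matrix l ** transpose P \<and>
      (\<forall>i. 0 < l i) \<and> (\<Sum>i\<in>UNIV. l i) = n * c \<and> (is_tight_frame K u \<longleftrightarrow> (\<forall>i. l i = c))"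
    if u: "feasible K \<alpha> u" for u :: "nat \<Rightarrow> real ^ 'n"
  proof -
    obtain P l where P: "orthogonal_matrix P" "frame_matrix K u = P ** diag_matrix l ** transpose P"
      using symmetric_matrix_diagonalization[OF transpose_frame_matrix] by metis
    have fr: "is_frame K u"
      using u by (simp add: feasible_def is_frame_def)
    have pos: "0 < l i" for i
    proof -
      have "is_eigenvalue (frame_matrix K u) (l i)"
        using P by (simp add: is_eigenvalue_diagonalized)
      then obtain x where x: "x \<noteq> 0" "frame_operator K u x = l i *\<^sub>R x"
        by (auto simp: is_eigenvalue_def frame_matrix_mult_vec)
      then show ?thesis
        using frame_operator_pos[OF fr x(1)]
        by (simp add: zero_less_mult_iff inner_ge_zero[THEN leD])
    qed
    have sum: "(\<Sum>i\<in>UNIV. l i) = n * c"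
      using trace[OF u] P by (simp add: trace_diagonalized)
    have "is_tight_frame K u \<longleftrightarrow> (\<forall>i. l i = c)"
    proof
      assume "is_tight_frame K u"
      then obtain a where a: "frame_matrix K u = mat a"
        using is_tight_frame_iff_frame_matrix[OF fr] by blast
      \<comment> \<open>Tightness only provides some constant \<open>a\<close>; comparing traces
        identifies it as \<open>c\<close>.\<close>
      have "trace (mat a :: real ^ 'n ^ 'n) = n * a"
        by (simp add: trace_def mat_def n_def)
      then have "a = c"
        using trace[OF u] a n by simp
      show "\<forall>i. l i = c"
      proof
        fix i
        have "is_eigenvalue (mat c :: real ^ 'n ^ 'n) (l i)"
          using P a \<open>a = c\<close> by (metis is_eigenvalue_diagonalized rangeI)
        then obtain x :: "real ^ 'n" where "x \<noteq> 0" "mat c *v x = l i *\<^sub>R x"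
          by (auto simp: is_eigenvalue_def)
        then show "l i = c"
          by (simp add: mat_mult_vec)
      qed
    next
      assume "\<forall>i. l i = c"
      then have "l = (\<lambda>_. c)" by blast
      then have "frame_matrix K u = mat c"
        using P by (simp add: const_diagonalized)
      then show "is_tight_frame K u"
        using is_tight_frame_iff_frame_matrix[OF fr] c by blast
    qed
    with P pos sum show ?thesis by blast
  qed
  have ex: "\<exists>u :: nat \<Rightarrow> real ^ 'n. feasible K \<alpha> u \<and> is_tight_frame K u"
  proof -
    \<comment> \<open>Monotonicity makes \<open>\<alpha> 1\<close> the largest target, so the bound
      on it by the mean \<open>c\<close> covers all of them.\<close>
    have "0 \<le> \<alpha> i \<and> \<alpha> i \<le> c" if "i \<in> {1..K}" for i
      using that assms(2)[OF that] assms(3)[of 1 i] assms(4) by (auto simp: c_def n_def)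
    then obtain u :: "nat \<Rightarrow> real ^ 'n" where "feasible K \<alpha> u" "frame_matrix K u = mat c"
      using tight_frame_exists[of K \<alpha> c] c nc unfolding n_def by blast
    then show ?thesis
      using is_tight_frame_iff_frame_matrix[of K u] c unfolding feasible_def is_frame_def by blast
  qed
  have P1: "n / c \<le> trace (matrix_inv (frame_matrix K u))"
    "trace (matrix_inv (frame_matrix K u)) = n / c \<longleftrightarrow> is_tight_frame K u"
    if u: "feasible K \<alpha> u" for u :: "nat \<Rightarrow> real ^ 'n"
  proof -
    obtain P l where *: "orthogonal_matrix P" "frame_matrix K u = P ** diag_matrix l ** transpose P"
      "\<And>i. 0 < l i" "(\<Sum>i\<in>UNIV. l i) = n * c" "is_tight_frame K u \<longleftrightarrow> (\<forall>i. l i = c)"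
      using spectrum[OF u] by blast
    have "trace (matrix_inv (frame_matrix K u)) = (\<Sum>i\<in>UNIV. 1 / l i)"
      using *(1-3) by (simp add: matrix_inv_diagonalized trace_diagonalized less_imp_neq[THEN not_sym])
    then show "n / c \<le> trace (matrix_inv (frame_matrix K u))"
      "trace (matrix_inv (frame_matrix K u)) = n / c \<longleftrightarrow> is_tight_frame K u"
      using sum_inverse_ge_mean[of l c] *(3-5) c unfolding n_def by auto
  qed
  have P2: "1 / c \<le> 1 / lambda_min (frame_matrix K u)"
    "1 / lambda_min (frame_matrix K u) = 1 / c \<longleftrightarrow> is_tight_frame K u"
    if u: "feasible K \<alpha> u" for u :: "nat \<Rightarrow> real ^ 'n"
  proof -
    obtain P l where *: "orthogonal_matrix P" "frame_matrix K u = P ** diag_matrix l ** transpose P"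
      "\<And>i. 0 < l i" "(\<Sum>i\<in>UNIV. l i) = n * c" "is_tight_frame K u \<longleftrightarrow> (\<forall>i. l i = c)"
      using spectrum[OF u] by blast
    have "lambda_min (frame_matrix K u) = Min (range l)"
      using * by (simp add: lambda_min_diagonalized)
    \<comment> \<open>Positivity is what lets the upper bound \<open>c\<close> on the minimum become
      a lower bound on its inverse.\<close>
    moreover have "0 < Min (range l)"
      using *(3) by auto
    ultimately show "1 / c \<le> 1 / lambda_min (frame_matrix K u)"
      "1 / lambda_min (frame_matrix K u) = 1 / c \<longleftrightarrow> is_tight_frame K u"
      using Min_le_mean[of l c] *(4,5) c unfolding n_def by (auto intro!: divide_left_mono)
  qed
  \<comment> \<open>Stated for the negated determinant so that the criterion for minimisers applies
    to the maximisation problem too.\<close>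
  have P3: "- (c ^ CARD('n)) \<le> - det (frame_matrix K u)"
    "- det (frame_matrix K u) = - (c ^ CARD('n)) \<longleftrightarrow> is_tight_frame K u"
    if u: "feasible K \<alpha> u" for u :: "nat \<Rightarrow> real ^ 'n"
  proof -
    obtain P l where *: "orthogonal_matrix P" "frame_matrix K u = P ** diag_matrix l ** transpose P"
      "\<And>i. 0 < l i" "(\<Sum>i\<in>UNIV. l i) = n * c" "is_tight_frame K u \<longleftrightarrow> (\<forall>i. l i = c)"
      using spectrum[OF u] by blast
    have "det (frame_matrix K u) = (\<Prod>i\<in>UNIV. l i)"
      using * by (simp add: det_diagonalized)
    then show "- (c ^ CARD('n)) \<le> - det (frame_matrix K u)"
      "- det (frame_matrix K u) = - (c ^ CARD('n)) \<longleftrightarrow> is_tight_frame K u"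
      using prod_le_mean_power[of l c] *(3-5) c unfolding n_def by auto
  qed
  note criterion = is_arg_min_iff_attains_bound
    [where P = "feasible K \<alpha>" and Q = "is_tight_frame K", OF _ _ ex assms(5)]
  show ?thesis
    unfolding is_arg_max_iff_is_arg_min_uminus
    by (intro conjI criterion[OF P1] criterion[OF P2] criterion[OF P3])
qed

end
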